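(* Consider von Plato's axiomatization of ordered affine geometry (the specific system of 22 axioms in J. von Plato, "A constructive theory of ordered affine geometry", Indag. Mathem., N.S. 9 (4), 549-562, 1998). Among its axioms is the following one, called I.7, in which $l,m,n$ range over lines: I.7: $\mathrm{Undir}(l,m)\wedge \mathrm{Undir}(l,\mathrm{rev}(m))\rightarrow \big(\mathrm{Undir}(l,n)\wedge \mathrm{Undir}(l,\mathrm{rev}(n))\big)\vee\big(\mathrm{Undir}(m,n)\wedge \mathrm{Undir}(m,\mathrm{rev}(n))\big)$. Let the new axiomatization 1 be obtained from von Plato's axiomatization by replacing the axiom I.7 with the following axiom, called ODO, and leaving the other 21 axioms unchanged: ODO: $\neg \mathrm{Undir}(l,\mathrm{rev}(m))\wedge\neg \mathrm{Undir}(l,n)\rightarrow \neg \mathrm{Undir}(m,\mathrm{rev}(n))$. Then the new axiomatization 1 is equivalent to von Plato's axiomatization; that is, ODO is derivable from von Plato's axiomatization, and I.7 is derivable from the new axiomatization 1.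
   Context: Von Plato's axiomatization of ordered affine geometry is a system of 22 axioms formulated with five basic relations, DiPt, DiLn, Undir, L-Apt and L-Con, and four constructions, $\mathrm{ln}(a,b)$, $\mathrm{pt}(a,b)$, $\mathrm{par}(l,m)$ and $\mathrm{rev}(l)$. Of these only two occur in I.7 and ODO: the basic relation $\mathrm{Undir}(l,m)$, meaning that $l$ and $m$ are unequally directed lines, and the construction $\mathrm{rev}(l)$, the reverse of the line $l$. Besides I.7, the axioms of von Plato's system in which $\mathrm{Undir}$ and $\mathrm{rev}$ are the only basic relation and construction considered here are the following three, which belong to both axiomatizations. I.5: $\neg \mathrm{Undir}(l,l)$. I.6: $\mathrm{Undir}(l,m)\rightarrow \mathrm{Undir}(l,n)\vee \mathrm{Undir}(m,n)$. I.8: $\mathrm{Undir}(l,m)\vee \mathrm{Undir}(l,\mathrm{rev}(m))$. All axioms are understood as universally quantified over lines $l,m,n$. With $\mathrm{Opp}(x,y)$ ("oppositely directed lines") defined as $\neg\mathrm{Undir}(x,\mathrm{rev}(y))$ and $\mathrm{Dir}(x,y)$ ("equally directed lines") defined as $\neg\mathrm{Undir}(x,y)$, ODO reads $\mathrm{Opp}(l,m)\wedge \mathrm{Dir}(l,n)\rightarrow \mathrm{Opp}(m,n)$. Derivability is in classical first-order logic. *)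

theory Defs
  imports Main
begin

text \<open>
  Two-sorted classical first-order logic without equality over the signature of ordered affine
  geometry. Constructions are total function symbols: \<open>Ln a b\<close> is the line
  through the points \<open>a\<close>, \<open>b\<close>; \<open>Pt l m\<close> the intersection point of the lines \<open>l\<close>, \<open>m\<close>;
  \<open>Par l a\<close> the parallel to \<open>l\<close> through \<open>a\<close>; \<open>Rev l\<close> the reverse of \<open>l\<close>.
  Variables are de Bruijn indices, counted separately for points and for lines: a point
  quantifier binds point index 0 only, a line quantifier line index 0 only.
\<close>

datatype pterm = PVar nat | Pt lterm lterm
  and lterm = LVar nat | Ln pterm pterm | Par lterm pterm | Rev lterm

datatype fm =
    Falsum
  | DiPt pterm pterm
  | DiLn lterm lterm
  | Undir lterm lterm
  | LApt pterm lterm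
  | LCon lterm lterm
  | And fm fm
  | Or fm fm
  | Imp fm fm
  | AllP fm
  | ExP fm
  | AllL fm
  | ExL fm

definition Neg :: "fm \<Rightarrow> fm" where
  "Neg \<phi> = Imp \<phi> Falsum"

text \<open>
  Simultaneous substitution of \<open>\<sigma>\<close> for the point variables and \<open>\<tau>\<close> for the line variables.
\<close>

primrec psub :: "(nat \<Rightarrow> pterm) \<Rightarrow> (nat \<Rightarrow> lterm) \<Rightarrow> pterm \<Rightarrow> pterm"
  and lsub :: "(nat \<Rightarrow> pterm) \<Rightarrow> (nat \<Rightarrow> lterm) \<Rightarrow> lterm \<Rightarrow> lterm" where
  "psub \<sigma> \<tau> (PVar n) = \<sigma> n"
| "psub \<sigma> \<tau> (Pt l m) = Pt (lsub \<sigma> \<tau> l) (lsub \<sigma> \<tau> m)"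
| "lsub \<sigma> \<tau> (LVar n) = \<tau> n"
| "lsub \<sigma> \<tau> (Ln a b) = Ln (psub \<sigma> \<tau> a) (psub \<sigma> \<tau> b)"
| "lsub \<sigma> \<tau> (Par l a) = Par (lsub \<sigma> \<tau> l) (psub \<sigma> \<tau> a)"
| "lsub \<sigma> \<tau> (Rev l) = Rev (lsub \<sigma> \<tau> l)"

primrec fsub :: "(nat \<Rightarrow> pterm) \<Rightarrow> (nat \<Rightarrow> lterm) \<Rightarrow> fm \<Rightarrow> fm" where
  "fsub \<sigma> \<tau> Falsum = Falsum"
| "fsub \<sigma> \<tau> (DiPt a b) = DiPt (psub \<sigma> \<tau> a) (psub \<sigma> \<tau> b)"
| "fsub \<sigma> \<tau> (DiLn l m) = DiLn (lsub \<sigma> \<tau> l) (lsub \<sigma> \<tau> m)"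
| "fsub \<sigma> \<tau> (Undir l m) = Undir (lsub \<sigma> \<tau> l) (lsub \<sigma> \<tau> m)"
| "fsub \<sigma> \<tau> (LApt a l) = LApt (psub \<sigma> \<tau> a) (lsub \<sigma> \<tau> l)"
| "fsub \<sigma> \<tau> (LCon l m) = LCon (lsub \<sigma> \<tau> l) (lsub \<sigma> \<tau> m)"
| "fsub \<sigma> \<tau> (And \<phi> \<psi>) = And (fsub \<sigma> \<tau> \<phi>) (fsub \<sigma> \<tau> \<psi>)"
| "fsub \<sigma> \<tau> (Or \<phi> \<psi>) = Or (fsub \<sigma> \<tau> \<phi>) (fsub \<sigma> \<tau> \<psi>)"
| "fsub \<sigma> \<tau> (Imp \<phi> \<psi>) = Imp (fsub \<sigma> \<tau> \<phi>) (fsub \<sigma> \<tau> \<psi>)"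
| "fsub \<sigma> \<tau> (AllP \<phi>) = AllP (fsub (case_nat (PVar 0) (\<lambda>n. psub (\<lambda>i. PVar (Suc i)) LVar (\<sigma> n)))
     (\<lambda>n. lsub (\<lambda>i. PVar (Suc i)) LVar (\<tau> n)) \<phi>)"
| "fsub \<sigma> \<tau> (ExP \<phi>) = ExP (fsub (case_nat (PVar 0) (\<lambda>n. psub (\<lambda>i. PVar (Suc i)) LVar (\<sigma> n)))
     (\<lambda>n. lsub (\<lambda>i. PVar (Suc i)) LVar (\<tau> n)) \<phi>)"
| "fsub \<sigma> \<tau> (AllL \<phi>) = AllL (fsub (\<lambda>n. psub PVar (\<lambda>i. LVar (Suc i)) (\<sigma> n))
     (case_nat (LVar 0) (\<lambda>n. lsub PVar (\<lambda>i. LVar (Suc i)) (\<tau> n))) \<phi>)"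
| "fsub \<sigma> \<tau> (ExL \<phi>) = ExL (fsub (\<lambda>n. psub PVar (\<lambda>i. LVar (Suc i)) (\<sigma> n))
     (case_nat (LVar 0) (\<lambda>n. lsub PVar (\<lambda>i. LVar (Suc i)) (\<tau> n))) \<phi>)"

definition shiftP :: "fm \<Rightarrow> fm" where
  "shiftP = fsub (\<lambda>n. PVar (Suc n)) LVar"

definition shiftL :: "fm \<Rightarrow> fm" where
  "shiftL = fsub PVar (\<lambda>n. LVar (Suc n))"

definition instP :: "pterm \<Rightarrow> fm \<Rightarrow> fm" where
  "instP a = fsub (case_nat a PVar) LVar"

definition instL :: "lterm \<Rightarrow> fm \<Rightarrow> fm" where
  "instL l = fsub PVar (case_nat l LVar)"

text \<open>
  Classical natural deduction from a set of assumptions. The eigenvariable conditions of the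
  quantifier rules are expressed by shifting all assumptions (and, for existential elimination,
  the conclusion), so that index 0 does not occur in them.
\<close>

inductive derives :: "fm set \<Rightarrow> fm \<Rightarrow> bool" (infix "\<turnstile>" 50) where
  Assm: "\<phi> \<in> \<Gamma> \<Longrightarrow> \<Gamma> \<turnstile> \<phi>"
| RAA: "insert (Neg \<phi>) \<Gamma> \<turnstile> Falsum \<Longrightarrow> \<Gamma> \<turnstile> \<phi>"
| AndI: "\<Gamma> \<turnstile> \<phi> \<Longrightarrow> \<Gamma> \<turnstile> \<psi> \<Longrightarrow> \<Gamma> \<turnstile> And \<phi> \<psi>"
| AndE1: "\<Gamma> \<turnstile> And \<phi> \<psi> \<Longrightarrow> \<Gamma> \<turnstile> \<phi>"
| AndE2: "\<Gamma> \<turnstile> And \<phi> \<psi> \<Longrightarrow> \<Gamma> \<turnstile> \<psi>"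
| OrI1: "\<Gamma> \<turnstile> \<phi> \<Longrightarrow> \<Gamma> \<turnstile> Or \<phi> \<psi>"
| OrI2: "\<Gamma> \<turnstile> \<psi> \<Longrightarrow> \<Gamma> \<turnstile> Or \<phi> \<psi>"
| OrE: "\<Gamma> \<turnstile> Or \<phi> \<psi> \<Longrightarrow> insert \<phi> \<Gamma> \<turnstile> \<chi> \<Longrightarrow> insert \<psi> \<Gamma> \<turnstile> \<chi> \<Longrightarrow> \<Gamma> \<turnstile> \<chi>"
| ImpI: "insert \<phi> \<Gamma> \<turnstile> \<psi> \<Longrightarrow> \<Gamma> \<turnstile> Imp \<phi> \<psi>"
| ImpE: "\<Gamma> \<turnstile> Imp \<phi> \<psi> \<Longrightarrow> \<Gamma> \<turnstile> \<phi> \<Longrightarrow> \<Gamma> \<turnstile> \<psi>"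
| AllPI: "shiftP ` \<Gamma> \<turnstile> \<phi> \<Longrightarrow> \<Gamma> \<turnstile> AllP \<phi>"
| AllPE: "\<Gamma> \<turnstile> AllP \<phi> \<Longrightarrow> \<Gamma> \<turnstile> instP a \<phi>"
| ExPI: "\<Gamma> \<turnstile> instP a \<phi> \<Longrightarrow> \<Gamma> \<turnstile> ExP \<phi>"
| ExPE: "\<Gamma> \<turnstile> ExP \<phi> \<Longrightarrow> insert \<phi> (shiftP ` \<Gamma>) \<turnstile> shiftP \<chi> \<Longrightarrow> \<Gamma> \<turnstile> \<chi>"
| AllLI: "shiftL ` \<Gamma> \<turnstile> \<phi> \<Longrightarrow> \<Gamma> \<turnstile> AllL \<phi>"
| AllLE: "\<Gamma> \<turnstile> AllL \<phi> \<Longrightarrow> \<Gamma> \<turnstile> instL l \<phi>"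
| ExLI: "\<Gamma> \<turnstile> instL l \<phi> \<Longrightarrow> \<Gamma> \<turnstile> ExL \<phi>"
| ExLE: "\<Gamma> \<turnstile> ExL \<phi> \<Longrightarrow> insert \<phi> (shiftL ` \<Gamma>) \<turnstile> shiftL \<chi> \<Longrightarrow> \<Gamma> \<turnstile> \<chi>"

text \<open>
  \<open>closed_fm i j \<phi>\<close>: all free point variables of \<open>\<phi>\<close> are below \<open>i\<close> and all free line variables
  below \<open>j\<close>.
\<close>

primrec closed_pt :: "nat \<Rightarrow> nat \<Rightarrow> pterm \<Rightarrow> bool"
  and closed_ln :: "nat \<Rightarrow> nat \<Rightarrow> lterm \<Rightarrow> bool" where
  "closed_pt i j (PVar n) \<longleftrightarrow> n < i"
| "closed_pt i j (Pt l m) \<longleftrightarrow> closed_ln i j l \<and> closed_ln i j m"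
| "closed_ln i j (LVar n) \<longleftrightarrow> n < j"
| "closed_ln i j (Ln a b) \<longleftrightarrow> closed_pt i j a \<and> closed_pt i j b"
| "closed_ln i j (Par l a) \<longleftrightarrow> closed_ln i j l \<and> closed_pt i j a"
| "closed_ln i j (Rev l) \<longleftrightarrow> closed_ln i j l"

primrec closed_fm :: "nat \<Rightarrow> nat \<Rightarrow> fm \<Rightarrow> bool" where
  "closed_fm i j Falsum \<longleftrightarrow> True"
| "closed_fm i j (DiPt a b) \<longleftrightarrow> closed_pt i j a \<and> closed_pt i j b"
| "closed_fm i j (DiLn l m) \<longleftrightarrow> closed_ln i j l \<and> closed_ln i j m"
| "closed_fm i j (Undir l m) \<longleftrightarrow> closed_ln i j l \<and> closed_ln i j m"
| "closed_fm i j (LApt a l) \<longleftrightarrow> closed_pt i j a \<and> closed_ln i j l"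
| "closed_fm i j (LCon l m) \<longleftrightarrow> closed_ln i j l \<and> closed_ln i j m"
| "closed_fm i j (And \<phi> \<psi>) \<longleftrightarrow> closed_fm i j \<phi> \<and> closed_fm i j \<psi>"
| "closed_fm i j (Or \<phi> \<psi>) \<longleftrightarrow> closed_fm i j \<phi> \<and> closed_fm i j \<psi>"
| "closed_fm i j (Imp \<phi> \<psi>) \<longleftrightarrow> closed_fm i j \<phi> \<and> closed_fm i j \<psi>"
| "closed_fm i j (AllP \<phi>) \<longleftrightarrow> closed_fm (Suc i) j \<phi>"
| "closed_fm i j (ExP \<phi>) \<longleftrightarrow> closed_fm (Suc i) j \<phi>"
| "closed_fm i j (AllL \<phi>) \<longleftrightarrow> closed_fm i (Suc j) \<phi>"
| "closed_fm i j (ExL \<phi>) \<longleftrightarrow> closed_fm i (Suc j) \<phi>"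

abbreviation sentence :: "fm \<Rightarrow> bool" where
  "sentence \<equiv> closed_fm 0 0"

text \<open>
  In axioms with three line quantifiers, \<open>l\<close>, \<open>m\<close>, \<open>n\<close> are \<open>LVar 2\<close>, \<open>LVar 1\<close>, \<open>LVar 0\<close>; with two,
  \<open>l\<close>, \<open>m\<close> are \<open>LVar 1\<close>, \<open>LVar 0\<close>.
\<close>

definition I5 :: fm where
  "I5 = AllL (Neg (Undir (LVar 0) (LVar 0)))"

definition I6 :: fm where
  "I6 = AllL (AllL (AllL (Imp (Undir (LVar 2) (LVar 1))
     (Or (Undir (LVar 2) (LVar 0)) (Undir (LVar 1) (LVar 0))))))"

definition I7 :: fm where
  "I7 = AllL (AllL (AllL (Imp
     (And (Undir (LVar 2) (LVar 1)) (Undir (LVar 2) (Rev (LVar 1))))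
     (Or (And (Undir (LVar 2) (LVar 0)) (Undir (LVar 2) (Rev (LVar 0))))
         (And (Undir (LVar 1) (LVar 0)) (Undir (LVar 1) (Rev (LVar 0))))))))"

definition I8 :: fm where
  "I8 = AllL (AllL (Or (Undir (LVar 1) (LVar 0)) (Undir (LVar 1) (Rev (LVar 0)))))"

definition ODO :: fm where
  "ODO = AllL (AllL (AllL (Imp
     (And (Neg (Undir (LVar 2) (Rev (LVar 1)))) (Neg (Undir (LVar 2) (LVar 0))))
     (Neg (Undir (LVar 1) (Rev (LVar 0)))))))"

text \<open>
  The parameter \<open>R\<close> stands for the axioms of von Plato's system other than I.5--I.8; they are
  common to both axiomatizations.
\<close>

definition von_Plato :: "fm set \<Rightarrow> fm set" where
  "von_Plato R = {I5, I6, I7, I8} \<union> R"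

definition new_axiomatization_1 :: "fm set \<Rightarrow> fm set" where
  "new_axiomatization_1 R = {I5, I6, ODO, I8} \<union> R"

definition equivalent_axiomatizations :: "fm set \<Rightarrow> fm set \<Rightarrow> bool" where
  "equivalent_axiomatizations \<Gamma> \<Delta> \<longleftrightarrow> (\<forall>\<phi>. \<Gamma> \<turnstile> \<phi> \<longleftrightarrow> \<Delta> \<turnstile> \<phi>)"

end

theory Submission
  imports Defs
begin

text \<open>
  By I.5 and I.6, Dir is an equivalence relation. Then ODO amounts to the symmetry of Opp, while
  I.7 says, contrapositively, that two lines which are each Dir or Opp to a third are Dir or Opp
  to one another. Given symmetry of Opp, each of the four cases of I.7 reduces to Dir being an
  equivalence relation.
  Conversely, if \<open>n\<close> is directed as \<open>rev m\<close> but \<open>m\<close> is not directed as \<open>rev n\<close>, then I.8 gives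
  \<open>Undir m n\<close>, so the premise of I.7 holds for \<open>m\<close>, \<open>n\<close>, and comparing both with the line
  \<open>m\<close> itself refutes its conclusion.
\<close>

text \<open>Induction with \<open>\<Delta>\<close> arbitrary, since the quantifier rules pass to
  shifted assumption sets; inclusion is preserved by taking images.\<close>

lemma weaken:
  assumes "\<Gamma> \<turnstile> \<phi>" "\<Gamma> \<subseteq> \<Delta>"
  shows "\<Delta> \<turnstile> \<phi>"
  using assms
proof (induction arbitrary: \<Delta> rule: derives.induct)
  case (RAA \<phi> \<Gamma>)
  show ?case using RAA.prems by (intro derives.RAA[OF RAA.IH]) auto
next
  case (OrE \<Gamma> \<phi> \<psi> \<chi>)
  show ?case
    by (rule derives.OrE[OF OrE.IH]) (use OrE.prems in auto)
next
  case (ImpI \<phi> \<Gamma> \<psi>)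
  show ?case using ImpI.prems by (intro derives.ImpI[OF ImpI.IH]) auto
next
  case (AllPI \<Gamma> \<phi>)
  show ?case using AllPI.prems by (intro derives.AllPI[OF AllPI.IH]) auto
next
  case (ExPE \<Gamma> \<phi> \<chi>)
  show ?case
    by (rule derives.ExPE[OF ExPE.IH]) (use ExPE.prems in auto)
next
  case (AllLI \<Gamma> \<phi>)
  show ?case using AllLI.prems by (intro derives.AllLI[OF AllLI.IH]) auto
next
  case (ExLE \<Gamma> \<phi> \<chi>)
  show ?case
    by (rule derives.ExLE[OF ExLE.IH]) (use ExLE.prems in auto)
next
  case (ImpE \<Gamma> \<phi> \<psi>)
  show ?case using ImpE.prems by (intro derives.ImpE[OF ImpE.IH])
next
  case (AndE1 \<Gamma> \<phi> \<psi>)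
  show ?case using AndE1.prems by (intro derives.AndE1[OF AndE1.IH])
next
  case (AndE2 \<Gamma> \<phi> \<psi>)
  show ?case using AndE2.prems by (intro derives.AndE2[OF AndE2.IH])
next
  case (ExPI \<Gamma> a \<phi>)
  show ?case using ExPI.prems by (intro derives.ExPI[OF ExPI.IH])
next
  case (ExLI \<Gamma> l \<phi>)
  show ?case using ExLI.prems by (intro derives.ExLI[OF ExLI.IH])
qed (auto intro: derives.Assm AndI OrI1 OrI2 AllPE AllLE)

lemma cut:
  assumes "\<Gamma> \<turnstile> \<phi>" "insert \<phi> \<Gamma> \<turnstile> \<psi>"
  shows "\<Gamma> \<turnstile> \<psi>"
  by (rule ImpE[OF ImpI[OF assms(2)] assms(1)])

lemma NegI: "insert \<phi> \<Gamma> \<turnstile> Falsum \<Longrightarrow> \<Gamma> \<turnstile> Neg \<phi>"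
  unfolding Neg_def by (rule ImpI)

lemma NegE: "\<Gamma> \<turnstile> Neg \<phi> \<Longrightarrow> \<Gamma> \<turnstile> \<phi> \<Longrightarrow> \<Gamma> \<turnstile> \<psi>"
  unfolding Neg_def by (rule RAA, rule weaken, rule ImpE, assumption+, blast)

text \<open>A classical case split: under \<open>Neg \<chi>\<close>, each conjunct follows by
  reductio from the corresponding branch, so the conjunction itself becomes derivable.\<close>

lemma Neg_AndE:
  assumes "\<Gamma> \<turnstile> Neg (And \<phi> \<psi>)" "insert (Neg \<phi>) \<Gamma> \<turnstile> \<chi>" "insert (Neg \<psi>) \<Gamma> \<turnstile> \<chi>"
  shows "\<Gamma> \<turnstile> \<chi>"
proof (rule RAA)
  let ?\<Delta> = "insert (Neg \<chi>) \<Gamma>"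
  have "?\<Delta> \<turnstile> \<theta>" if "insert (Neg \<theta>) \<Gamma> \<turnstile> \<chi>" for \<theta>
  proof (rule RAA)
    show "insert (Neg \<theta>) ?\<Delta> \<turnstile> Falsum"
      by (rule NegE[OF Assm weaken[OF that]]) auto
  qed
  with assms(2,3) have "?\<Delta> \<turnstile> And \<phi> \<psi>" by (intro AndI)
  moreover have "?\<Delta> \<turnstile> Neg (And \<phi> \<psi>)"
    using assms(1) by (rule weaken) blast
  ultimately show "?\<Delta> \<turnstile> Falsum" by (rule NegE[rotated])
qed

lemma Neg_OrD1: "\<Gamma> \<turnstile> Neg (Or \<phi> \<psi>) \<Longrightarrow> \<Gamma> \<turnstile> Neg \<phi>"
  by (rule NegI, rule NegE[OF weaken OrI1[OF Assm]]) auto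

lemma Neg_OrD2: "\<Gamma> \<turnstile> Neg (Or \<phi> \<psi>) \<Longrightarrow> \<Gamma> \<turnstile> Neg \<psi>"
  by (rule NegI, rule NegE[OF weaken OrI2[OF Assm]]) auto

text \<open>Composition of substitutions serves the instantiation of nested quantifiers: a term
  substituted under a remaining quantifier is lifted, and instantiating that quantifier undoes the
  lifting. Terms suffice, because the axiom matrices are quantifier-free.\<close>

lemma psub_psub: "psub \<sigma> \<tau> (psub \<sigma>' \<tau>' a) = psub (\<lambda>n. psub \<sigma> \<tau> (\<sigma>' n)) (\<lambda>n. lsub \<sigma> \<tau> (\<tau>' n)) a"
  and lsub_lsub: "lsub \<sigma> \<tau> (lsub \<sigma>' \<tau>' l) = lsub (\<lambda>n. psub \<sigma> \<tau> (\<sigma>' n)) (\<lambda>n. lsub \<sigma> \<tau> (\<tau>' n)) l"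
  by (induction a and l) auto

lemma psub_Var [simp]: "psub PVar LVar a = a"
  and lsub_Var [simp]: "lsub PVar LVar l = l"
  by (induction a and l) auto

text \<open>\<open>numeral_2_eq_2\<close> puts the index 2 into successor form, on which
  \<open>case_nat\<close> computes.\<close>

lemmas inst_simps = Neg_def instL_def lsub_lsub numeral_2_eq_2

lemma I5_inst:
  assumes "I5 \<in> \<Gamma>"
  shows "\<Gamma> \<turnstile> Neg (Undir l l)"
  using AllLE[OF Assm[OF assms, unfolded I5_def], of l] by (simp add: inst_simps)

lemma I6_inst:
  assumes "I6 \<in> \<Gamma>"
  shows "\<Gamma> \<turnstile> Imp (Undir l m) (Or (Undir l n) (Undir m n))"
  using AllLE[OF AllLE[OF AllLE[OF Assm[OF assms, unfolded I6_def], of l,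
        unfolded instL_def fsub.simps], of m, unfolded instL_def fsub.simps], of n]
  by (simp add: inst_simps)

lemma I7_inst:
  assumes "I7 \<in> \<Gamma>"
  shows "\<Gamma> \<turnstile> Imp (And (Undir l m) (Undir l (Rev m)))
    (Or (And (Undir l n) (Undir l (Rev n))) (And (Undir m n) (Undir m (Rev n))))"
  using AllLE[OF AllLE[OF AllLE[OF Assm[OF assms, unfolded I7_def], of l,
        unfolded instL_def fsub.simps], of m, unfolded instL_def fsub.simps], of n]
  by (simp add: inst_simps)

lemma I8_inst:
  assumes "I8 \<in> \<Gamma>"
  shows "\<Gamma> \<turnstile> Or (Undir l m) (Undir l (Rev m))"
  using AllLE[OF AllLE[OF Assm[OF assms, unfolded I8_def], of l,
      unfolded instL_def fsub.simps], of m]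
  by (simp add: inst_simps)

lemma ODO_inst:
  assumes "ODO \<in> \<Gamma>"
  shows "\<Gamma> \<turnstile> Imp (And (Neg (Undir l (Rev m))) (Neg (Undir l n))) (Neg (Undir m (Rev n)))"
  using AllLE[OF AllLE[OF AllLE[OF Assm[OF assms, unfolded ODO_def Neg_def], of l,
        unfolded instL_def fsub.simps], of m, unfolded instL_def fsub.simps], of n]
  by (simp add: inst_simps)

text \<open>The axioms have no free variables; so \<open>AllLI\<close> can be used repeatedly
  without changing the set of assumptions.\<close>

lemma shiftL_axioms:
  "shiftL I5 = I5" "shiftL I6 = I6" "shiftL I7 = I7" "shiftL I8 = I8" "shiftL ODO = ODO"
  by (simp_all add: shiftL_def I5_def I6_def I7_def I8_def ODO_def Neg_def numeral_2_eq_2)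

lemma dir_cancel:
  assumes "I6 \<in> \<Gamma>" "\<Gamma> \<turnstile> Neg (Undir l n)" "\<Gamma> \<turnstile> Neg (Undir m n)"
  shows "\<Gamma> \<turnstile> Neg (Undir l m)"
proof (rule NegI)
  let ?\<Delta> = "insert (Undir l m) \<Gamma>"
  have "?\<Delta> \<turnstile> Or (Undir l n) (Undir m n)"
    using assms(1) by (intro ImpE[OF I6_inst Assm]) auto
  then show "?\<Delta> \<turnstile> Falsum"
  proof (rule OrE)
    show "insert (Undir l n) ?\<Delta> \<turnstile> Falsum"
      by (rule NegE[OF weaken[OF assms(2)] Assm]) auto
    show "insert (Undir m n) ?\<Delta> \<turnstile> Falsum"
      by (rule NegE[OF weaken[OF assms(3)] Assm]) auto
  qed
qed

text \<open>In \<open>dir_cancel\<close>, the common third line is \<open>m\<close> itself.\<close>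

lemma dir_sym:
  assumes "I5 \<in> \<Gamma>" "I6 \<in> \<Gamma>" "\<Gamma> \<turnstile> Neg (Undir l m)"
  shows "\<Gamma> \<turnstile> Neg (Undir m l)"
  using dir_cancel[OF assms(2) I5_inst[OF assms(1)] assms(3)] .

lemma dir_trans:
  assumes "I5 \<in> \<Gamma>" "I6 \<in> \<Gamma>" "\<Gamma> \<turnstile> Neg (Undir l m)" "\<Gamma> \<turnstile> Neg (Undir m n)"
  shows "\<Gamma> \<turnstile> Neg (Undir l n)"
  using dir_cancel[OF assms(2,3) dir_sym[OF assms(1,2,4)]] .

lemma opp_sym_I7:
  assumes "I5 \<in> \<Gamma>" "I6 \<in> \<Gamma>" "I7 \<in> \<Gamma>" "I8 \<in> \<Gamma>"
    and opp: "\<Gamma> \<turnstile> Neg (Undir n (Rev m))"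
  shows "\<Gamma> \<turnstile> Neg (Undir m (Rev n))"
proof (rule NegI)
  let ?\<Delta> = "insert (Undir m (Rev n)) \<Gamma>"
  have ax: "I5 \<in> ?\<Delta>" "I6 \<in> ?\<Delta>" "I7 \<in> ?\<Delta>" "I8 \<in> ?\<Delta>" using assms(1-4) by auto
  have "?\<Delta> \<turnstile> Undir m n"
  proof (rule RAA)
    let ?\<Theta> = "insert (Neg (Undir m n)) ?\<Delta>"
    have dir: "?\<Theta> \<turnstile> Neg (Undir n m)" using ax by (intro dir_sym[OF _ _ Assm]) auto
    \<comment> \<open>I.8 is taken for the pair \<open>n\<close>, \<open>m\<close>: for
      \<open>m\<close>, \<open>n\<close> its second disjunct is already assumed, so nothing would
      follow.\<close>
    have "?\<Theta> \<turnstile> Or (Undir n m) (Undir n (Rev m))" using ax by (intro I8_inst) auto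
    then show "?\<Theta> \<turnstile> Falsum"
    proof (rule OrE)
      show "insert (Undir n m) ?\<Theta> \<turnstile> Falsum"
        by (rule NegE[OF weaken[OF dir] Assm]) auto
      show "insert (Undir n (Rev m)) ?\<Theta> \<turnstile> Falsum"
        by (rule NegE[OF weaken[OF opp] Assm]) auto
    qed
  qed
  then have "?\<Delta> \<turnstile> Or (And (Undir m m) (Undir m (Rev m))) (And (Undir n m) (Undir n (Rev m)))"
    by (rule ImpE[OF I7_inst[OF ax(3)] AndI[OF _ Assm]]) auto
  then show "?\<Delta> \<turnstile> Falsum"
  proof (rule OrE)
    show "insert (And (Undir m m) (Undir m (Rev m))) ?\<Delta> \<turnstile> Falsum"
      using ax by (intro NegE[OF I5_inst AndE1[OF Assm]]) auto
    show "insert (And (Undir n m) (Undir n (Rev m))) ?\<Delta> \<turnstile> Falsum"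
      by (rule NegE[OF weaken[OF opp] AndE2[OF Assm]]) auto
  qed
qed

text \<open>ODO with \<open>n\<close> in the role of both its first and its third line.\<close>

lemma opp_sym_ODO:
  assumes "I5 \<in> \<Gamma>" "ODO \<in> \<Gamma>" "\<Gamma> \<turnstile> Neg (Undir n (Rev m))"
  shows "\<Gamma> \<turnstile> Neg (Undir m (Rev n))"
  by (rule ImpE[OF ODO_inst[OF assms(2)] AndI[OF assms(3) I5_inst[OF assms(1)]]])

text \<open>The line \<open>n\<close> is Dir to \<open>l\<close>, which is Dir to
  \<open>rev m\<close>; hence Opp holds for \<open>n\<close>, \<open>m\<close>, and symmetry of Opp
  turns it round.\<close>

lemma derives_ODO: "{I5, I6, I7, I8} \<turnstile> ODO"
proof -
  let ?H = "And (Neg (Undir (LVar 2) (Rev (LVar 1)))) (Neg (Undir (LVar 2) (LVar 0)))"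
  let ?\<Gamma> = "insert ?H {I5, I6, I7, I8}"
  have H: "?\<Gamma> \<turnstile> ?H" by (rule Assm) simp
  have "?\<Gamma> \<turnstile> Neg (Undir (LVar 0) (Rev (LVar 1)))"
    by (rule dir_trans[OF _ _ dir_sym[OF _ _ AndE2[OF H]] AndE1[OF H]]) auto
  then have "?\<Gamma> \<turnstile> Neg (Undir (LVar 1) (Rev (LVar 0)))"
    by (rule opp_sym_I7[rotated -1]) auto
  then show ?thesis
    unfolding ODO_def by (intro AllLI) (simp add: shiftL_axioms ImpI)
qed

lemma derives_I7: "{I5, I6, ODO} \<turnstile> I7"
proof -
  let ?l = "LVar 2" and ?m = "LVar 1" and ?n = "LVar 0"
  let ?H = "And (Undir ?l ?m) (Undir ?l (Rev ?m))"
  let ?A = "And (Undir ?l ?n) (Undir ?l (Rev ?n))"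
  let ?B = "And (Undir ?m ?n) (Undir ?m (Rev ?n))"
  let ?\<Gamma> = "insert (Neg (Or ?A ?B)) (insert ?H {I5, I6, ODO})"
  \<comment> \<open>The premise of I.7 says that \<open>?l\<close> and \<open>?m\<close> are neither
    Dir nor Opp, so a case closes as soon as one of these is derived.\<close>
  have contra: "\<Delta> \<turnstile> Falsum"
    if "?\<Gamma> \<subseteq> \<Delta>" "\<Delta> \<turnstile> Neg (Undir ?l ?m) \<or> \<Delta> \<turnstile> Neg (Undir ?l (Rev ?m))" for \<Delta>
  proof -
    have "\<Delta> \<turnstile> ?H" using that(1) by (intro Assm) auto
    then show ?thesis using that(2) by (metis AndE1 AndE2 NegE)
  qed
  have nOr: "?\<Gamma> \<turnstile> Neg (Or ?A ?B)" by (rule Assm) simp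
  have nB: "insert \<phi> ?\<Gamma> \<turnstile> Neg ?B" for \<phi>
    using Neg_OrD2[OF nOr] by (rule weaken) blast
  have "?\<Gamma> \<turnstile> Falsum"
  proof (rule Neg_AndE[OF Neg_OrD1[OF nOr]])
    show "insert (Neg (Undir ?l ?n)) ?\<Gamma> \<turnstile> Falsum" (is "?\<Delta> \<turnstile> _")
    proof (rule Neg_AndE[OF nB])
      show "insert (Neg (Undir ?m ?n)) ?\<Delta> \<turnstile> Falsum"
        by (rule contra, blast, rule disjI1, rule dir_cancel[of _ _ ?n]) (auto intro: Assm)
      \<comment> \<open>Symmetry of Opp makes \<open>?n\<close> Dir to \<open>Rev ?m\<close>, and
        \<open>?l\<close> is Dir to \<open>?n\<close>.\<close>
      show "insert (Neg (Undir ?m (Rev ?n))) ?\<Delta> \<turnstile> Falsum"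
        by (rule contra, blast, rule disjI2, rule dir_trans[OF _ _ Assm opp_sym_ODO[OF _ _ Assm]])
          auto
    qed
    show "insert (Neg (Undir ?l (Rev ?n))) ?\<Gamma> \<turnstile> Falsum" (is "?\<Delta> \<turnstile> _")
    proof (rule Neg_AndE[OF nB])
      \<comment> \<open>Symmetry of Opp is used twice: first \<open>?n\<close> is Dir to
        \<open>Rev ?l\<close>, hence so is \<open>?m\<close>; then this is turned into
        \<open>?l\<close> being Dir to \<open>Rev ?m\<close>.\<close>
      show "insert (Neg (Undir ?m ?n)) ?\<Delta> \<turnstile> Falsum"
        by (rule contra, blast, rule disjI2, rule opp_sym_ODO[OF _ _
              dir_trans[OF _ _ Assm opp_sym_ODO[OF _ _ Assm]]]) auto
      show "insert (Neg (Undir ?m (Rev ?n))) ?\<Delta> \<turnstile> Falsum"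
        by (rule contra, blast, rule disjI1, rule dir_cancel[of _ _ "Rev ?n"]) (auto intro: Assm)
    qed
  qed
  then have "insert ?H {I5, I6, ODO} \<turnstile> Or ?A ?B" by (rule RAA)
  then show ?thesis
    unfolding I7_def by (intro AllLI) (simp add: shiftL_axioms ImpI)
qed

theorem theorem1:
  fixes R :: "fm set"
  assumes "\<And>\<phi>. \<phi> \<in> R \<Longrightarrow> sentence \<phi>"
  shows "equivalent_axiomatizations (von_Plato R) (new_axiomatization_1 R)
    \<and> von_Plato R \<turnstile> ODO
    \<and> new_axiomatization_1 R \<turnstile> I7"
proof (intro conjI)
  show ODO: "von_Plato R \<turnstile> ODO"
    using derives_ODO by (rule weaken) (auto simp: von_Plato_def)
  show I7: "new_axiomatization_1 R \<turnstile> I7"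
    using derives_I7 by (rule weaken) (auto simp: new_axiomatization_1_def)
  \<comment> \<open>Adding the derived I.7 gives a set that contains all of
    \<open>von_Plato R\<close>; the converse direction adds ODO in the same way.\<close>
  have "new_axiomatization_1 R \<turnstile> \<phi>" if "von_Plato R \<turnstile> \<phi>" for \<phi>
    by (rule cut[OF I7 weaken[OF that]])
      (auto simp: von_Plato_def new_axiomatization_1_def)
  moreover have "von_Plato R \<turnstile> \<phi>" if "new_axiomatization_1 R \<turnstile> \<phi>" for \<phi>
    by (rule cut[OF ODO weaken[OF that]])
      (auto simp: von_Plato_def new_axiomatization_1_def)
  ultimately show "equivalent_axiomatizations (von_Plato R) (new_axiomatization_1 R)"
    unfolding equivalent_axiomatizations_def by blast
qed

end
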